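(* For all integers $m\ge 0$ and $N\ge 1$ and all $z\in\mathbb{C}$, the generalized Bernoulli polynomials $B_m^N$ and the generalized Euler polynomials $E_m^N$ satisfy $$B_m^N(z)=\frac{1}{2^m}\sum_{k=0}^m\binom{m}{k}E_k^N(z)\,B_{m-k}^N(z).$$
   Context: The generalized Bernoulli and Euler polynomials of degree $m$ and order $N$ are defined by $$\frac{\omega^N e^{\omega z}}{(e^\omega-1)^N}=\sum_{m=0}^\infty\frac{B_m^N(z)}{m!}\omega^m\ (|\omega|<2\pi),\qquad \frac{2^N e^{\omega z}}{(e^\omega+1)^N}=\sum_{m=0}^\infty\frac{E_m^N(z)}{m!}\omega^m\ (|\omega|<\pi).$$ *)

theory Defs
  imports "HOL-Complex_Analysis.Complex_Analysis" "HOL-Computational_Algebra.Polynomial"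
begin

text \<open>
  The left-hand side of the Bernoulli generating function has a removable singularity at
  \<open>\<omega> = 0\<close>; since division by zero yields zero in HOL, the expansion is required on the
  punctured disc only. The lemmas \<open>gen_bernoulli_poly_ex1\<close> and \<open>gen_euler_poly_ex1\<close>
  show that the definite descriptions are well-defined.
\<close>

definition gen_bernoulli_poly :: "nat \<Rightarrow> nat \<Rightarrow> complex poly" where
  "gen_bernoulli_poly N = (THE B. \<forall>z \<omega> :: complex. 0 < norm \<omega> \<and> norm \<omega> < 2 * pi \<longrightarrow>
     (\<lambda>m. poly (B m) z / fact m * \<omega> ^ m) sums (\<omega> ^ N * exp (\<omega> * z) / (exp \<omega> - 1) ^ N))"

definition gen_euler_poly :: "nat \<Rightarrow> nat \<Rightarrow> complex poly" where
  "gen_euler_poly N = (THE E. \<forall>z \<omega> :: complex. norm \<omega> < pi \<longrightarrow>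
     (\<lambda>m. poly (E m) z / fact m * \<omega> ^ m) sums (2 ^ N * exp (\<omega> * z) / (exp \<omega> + 1) ^ N))"

lemma appell_exists:
  assumes G: "G holomorphic_on ball 0 r"
  shows "\<exists>B :: nat \<Rightarrow> complex poly. \<forall>z \<omega>. norm \<omega> < r \<longrightarrow>
           (\<lambda>m. poly (B m) z / fact m * \<omega> ^ m) sums (G \<omega> * exp (\<omega> * z))"
proof -
  define a where "a n = (deriv ^^ n) G 0 / fact n" for n
  define B :: "nat \<Rightarrow> complex poly" where
    "B m = smult (fact m) (\<Sum>k\<le>m. monom (a (m - k) / fact k) k)" for m
  have a: "(\<lambda>n. a n * w ^ n) sums G w" if "norm w < r" for w
    using holomorphic_power_series[OF G, of w] that by (simp add: a_def)
  have "(\<lambda>m. poly (B m) z / fact m * w ^ m) sums (G w * exp (w * z))" if w: "norm w < r" for z w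
  proof -
    obtain t where t: "norm w < t" "t < r" using w dense by blast
    have "norm (complex_of_real t) = t" using t norm_ge_zero[of w] by (simp del: norm_ge_zero)
    hence "summable (\<lambda>k. norm (a k * w ^ k))"
      using powser_insidea[of a "complex_of_real t" w] a[of "complex_of_real t"] t
      by (auto dest: sums_summable)
    moreover have "summable (\<lambda>k. norm ((w * z) ^ k /\<^sub>R fact k))"
      by (rule summable_norm_exp)
    ultimately have "(\<lambda>m. \<Sum>k\<le>m. ((w * z) ^ k /\<^sub>R fact k) * (a (m - k) * w ^ (m - k)))
        sums ((\<Sum>k. (w * z) ^ k /\<^sub>R fact k) * (\<Sum>k. a k * w ^ k))"
      by (intro Cauchy_product_sums)
    also have "(\<Sum>k. a k * w ^ k) = G w" using a[OF w] by (simp add: sums_iff)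
    also have "(\<Sum>k. (w * z) ^ k /\<^sub>R fact k) = exp (w * z)" by (simp add: exp_def)
    also have "(\<lambda>m. \<Sum>k\<le>m. ((w * z) ^ k /\<^sub>R fact k) * (a (m - k) * w ^ (m - k)))
        = (\<lambda>m. poly (B m) z / fact m * w ^ m)"
    proof
      fix m
      have "((w * z) ^ k /\<^sub>R fact k) * (a (m - k) * w ^ (m - k))
          = (a (m - k) / fact k * z ^ k) * w ^ m" if "k \<le> m" for k
      proof -
        have "w ^ m = w ^ k * w ^ (m - k)" using that by (simp flip: power_add)
        thus ?thesis by (simp add: power_mult_distrib scaleR_conv_of_real field_simps)
      qed
      thus "(\<Sum>k\<le>m. ((w * z) ^ k /\<^sub>R fact k) * (a (m - k) * w ^ (m - k)))
          = poly (B m) z / fact m * w ^ m"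
        by (simp add: B_def poly_sum poly_monom sum_distrib_right)
    qed
    finally show ?thesis by (simp add: mult.commute)
  qed
  thus ?thesis by blast
qed

lemma appell_unique:
  fixes B C :: "nat \<Rightarrow> complex poly"
  assumes r: "r > 0"
    and B: "\<And>z \<omega>. 0 < norm \<omega> \<Longrightarrow> norm \<omega> < r \<Longrightarrow> (\<lambda>m. poly (B m) z / fact m * \<omega> ^ m) sums F z \<omega>"
    and C: "\<And>z \<omega>. 0 < norm \<omega> \<Longrightarrow> norm \<omega> < r \<Longrightarrow> (\<lambda>m. poly (C m) z / fact m * \<omega> ^ m) sums F z \<omega>"
  shows "B = C"
proof
  fix m
  have "poly (B m) z = poly (C m) z" for z
  proof -
    define d where "d n = poly (B n) z / fact n - poly (C n) z / fact n" for n
    have d: "(\<lambda>n. d n * w ^ n) sums 0" if "w \<noteq> 0" "norm w < r" for w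
      using sums_diff[OF B[of w z] C[of w z]] that by (simp add: d_def algebra_simps)
    have d0: "d 0 = 0"
      using powser_limit_0_strong[of r d "\<lambda>_. 0", OF r d] by (simp add: tendsto_const_iff)
    have "d n = 0" for n
    proof (rule ccontr)
      assume n: "d n \<noteq> 0"
      hence "n > 0" using d0 by (cases n) auto
      have "(\<lambda>n. d n * (w - 0) ^ n) sums (\<lambda>_. 0) w" if "norm (w - 0) < r" for w
        using d[of w] that d0 by (cases "w = 0") auto
      then obtain s where "0 < s" "\<And>w::complex. w \<in> cball 0 s - {0} \<Longrightarrow> (0::complex) \<noteq> 0"
        using powser_0_nonzero[of r 0 d "\<lambda>_. 0" n] r n \<open>n > 0\<close> by blast
      from this(2)[of "of_real s"] this(1) show False by simp
    qed
    from this[of m] show ?thesis by (simp add: d_def)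
  qed
  thus "B m = C m" by (simp add: poly_eq_poly_eq_iff[symmetric] fun_eq_iff)
qed

lemma gen_bernoulli_poly_ex1:
  "\<exists>!B :: nat \<Rightarrow> complex poly. \<forall>z \<omega> :: complex. 0 < norm \<omega> \<and> norm \<omega> < 2 * pi \<longrightarrow>
     (\<lambda>m. poly (B m) z / fact m * \<omega> ^ m) sums (\<omega> ^ N * exp (\<omega> * z) / (exp \<omega> - 1) ^ N)"
proof -
  define g where "g w = (if w = 0 then 1 else (exp w - 1) / w)" for w :: complex
  have "g holomorphic_on UNIV"
  proof (rule no_isolated_singularity'[of "{0}"])
    show "(g \<longlongrightarrow> g z) (at z within UNIV)" if "z \<in> {0}" for z
    proof -
      have "(g \<longlongrightarrow> 1) (at 0)"
        using lim_exp_minus_1 by (rule Lim_transform_eventually)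
          (auto simp: g_def eventually_at_filter)
      thus ?thesis using that by (simp add: g_def)
    qed
    have "(\<lambda>w::complex. (exp w - 1) / w) holomorphic_on (UNIV - {0})"
      by (intro holomorphic_intros) auto
    thus "g holomorphic_on (UNIV - {0})"
      by (rule holomorphic_transform) (auto simp: g_def)
  qed auto
  hence hol: "g holomorphic_on ball 0 (2 * pi)" by (rule holomorphic_on_subset) auto
  have nz: "g w \<noteq> 0" if "w \<in> ball 0 (2 * pi)" for w
  proof
    assume "g w = 0"
    hence w: "w \<noteq> 0" "exp w = 1" by (auto simp: g_def split: if_splits)
    then obtain n :: int where n: "Re w = 0" "Im w = of_int (2 * n) * pi"
      by (auto simp: exp_eq_1)
    have "n \<noteq> 0" using w n by (auto simp: complex_eq_iff)
    hence "\<bar>of_int n\<bar> \<ge> (1::real)" by linarith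
    hence "\<bar>Im w\<bar> \<ge> 2 * pi" using n by (simp add: abs_mult)
    thus False using that abs_Im_le_cmod[of w] by simp
  qed
  have "(\<lambda>w. inverse (g w) ^ N) holomorphic_on ball 0 (2 * pi)"
    using hol nz by (intro holomorphic_intros) auto
  from appell_exists[OF this] obtain B :: "nat \<Rightarrow> complex poly" where
    B: "\<And>z w. norm w < 2 * pi \<Longrightarrow>
          (\<lambda>m. poly (B m) z / fact m * w ^ m) sums (inverse (g w) ^ N * exp (w * z))"
    by blast
  show ?thesis
  proof (rule ex_ex1I)
    show "\<exists>B :: nat \<Rightarrow> complex poly. \<forall>z \<omega> :: complex. 0 < norm \<omega> \<and> norm \<omega> < 2 * pi \<longrightarrow>
        (\<lambda>m. poly (B m) z / fact m * \<omega> ^ m) sums (\<omega> ^ N * exp (\<omega> * z) / (exp \<omega> - 1) ^ N)"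
    proof (intro exI[of _ B] allI impI)
      fix z w :: complex
      assume w: "0 < norm w \<and> norm w < 2 * pi"
      hence "inverse (g w) ^ N * exp (w * z) = w ^ N * exp (w * z) / (exp w - 1) ^ N"
        by (simp add: g_def power_divide)
      thus "(\<lambda>m. poly (B m) z / fact m * w ^ m) sums (w ^ N * exp (w * z) / (exp w - 1) ^ N)"
        using B[of w z] w by simp
    qed
  qed (rule appell_unique[of "2 * pi"], auto)
qed

lemma gen_euler_poly_ex1:
  "\<exists>!E :: nat \<Rightarrow> complex poly. \<forall>z \<omega> :: complex. norm \<omega> < pi \<longrightarrow>
     (\<lambda>m. poly (E m) z / fact m * \<omega> ^ m) sums (2 ^ N * exp (\<omega> * z) / (exp \<omega> + 1) ^ N)"
proof -
  have nz: "exp w + 1 \<noteq> 0" if "w \<in> ball 0 pi" for w :: complex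
  proof
    assume "exp w + 1 = 0"
    hence "exp w = exp (\<i> * pi)" by (simp add: add_eq_0_iff2)
    then obtain n :: int where n: "w = \<i> * pi + (of_int (2 * n) * pi) * \<i>"
      unfolding exp_eq by blast
    have "Im w = of_int (2 * n + 1) * pi" by (simp add: n algebra_simps)
    moreover have "\<bar>2 * n + 1\<bar> \<ge> 1" by presburger
    hence "\<bar>of_int (2 * n + 1)\<bar> \<ge> (1::real)" by linarith
    ultimately have "\<bar>Im w\<bar> \<ge> pi" by (simp add: abs_mult)
    thus False using that abs_Im_le_cmod[of w] by simp
  qed
  have "(\<lambda>w::complex. 2 ^ N / (exp w + 1) ^ N) holomorphic_on ball 0 pi"
    using nz by (intro holomorphic_intros) auto
  from appell_exists[OF this] have "\<exists>E :: nat \<Rightarrow> complex poly. \<forall>z \<omega> :: complex. norm \<omega> < pi \<longrightarrow>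
      (\<lambda>m. poly (E m) z / fact m * \<omega> ^ m) sums (2 ^ N * exp (\<omega> * z) / (exp \<omega> + 1) ^ N)"
    by simp
  thus ?thesis
    by (rule ex_ex1I) (rule appell_unique[of pi], auto)
qed

end

theory Submission
  imports Defs
begin

text \<open>
  The identity is the coefficient form of the difference of squares
  \<open>(e\<^sup>\<omega> + 1) (e\<^sup>\<omega> - 1) = e\<^sup>2\<^sup>\<omega> - 1\<close>: it shows that the product of the Euler and the Bernoulli
  generating functions at \<open>\<omega>\<close>, both with the same \<open>z\<close>, is the Bernoulli generating function
  at \<open>2\<omega>\<close>.  Products of exponential generating functions correspond to binomial convolutions
  of coefficients (\<open>egf_product_sums\<close>), and substituting \<open>\<omega>/2\<close> for \<open>\<omega>\<close> produces the factor
  \<open>1/2\<^sup>m\<close>.  The convolution on the right-hand side is a polynomial in \<open>z\<close>, so the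
  uniqueness part of \<open>gen_bernoulli_poly_ex1\<close> identifies it with the Bernoulli polynomial
  without any further comparison of coefficients.
\<close>

lemma gen_bernoulli_poly_sums:
  assumes "0 < norm w" "norm w < 2 * pi"
  shows "(\<lambda>m. poly (gen_bernoulli_poly N m) z / fact m * w ^ m) sums
           (w ^ N * exp (w * z) / (exp w - 1) ^ N)"
  using theI'[OF gen_bernoulli_poly_ex1[of N]] assms
  unfolding gen_bernoulli_poly_def by blast

lemma gen_euler_poly_sums:
  assumes "norm w < pi"
  shows "(\<lambda>m. poly (gen_euler_poly N m) z / fact m * w ^ m) sums
           (2 ^ N * exp (w * z) / (exp w + 1) ^ N)"
  using theI'[OF gen_euler_poly_ex1[of N]] assms
  unfolding gen_euler_poly_def by blast

lemma gen_bernoulli_poly_eqI: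
  assumes "\<And>z w. 0 < norm w \<Longrightarrow> norm w < 2 * pi \<Longrightarrow>
             (\<lambda>m. poly (C m) z / fact m * w ^ m) sums (w ^ N * exp (w * z) / (exp w - 1) ^ N)"
  shows "gen_bernoulli_poly N = C"
  unfolding gen_bernoulli_poly_def
  by (rule the1_equality[OF gen_bernoulli_poly_ex1]) (use assms in blast)

text \<open>
  Convergence at a point of larger modulus makes both series absolutely convergent at \<open>w\<close>, so
  that their Cauchy product converges; the factorials turn its coefficients into binomial ones.
  Only nonzero points need to be inspected, which suits the Bernoulli series, whose sum is given
  by a quotient whose value at \<open>0\<close> need not be that of the series.
\<close>

lemma egf_product_sums:
  fixes a b :: "nat \<Rightarrow> complex" and f g :: "complex \<Rightarrow> complex"
  assumes a: "\<And>w. 0 < norm w \<Longrightarrow> norm w < r \<Longrightarrow> (\<lambda>n. a n / fact n * w ^ n) sums f w"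
    and b: "\<And>w. 0 < norm w \<Longrightarrow> norm w < r \<Longrightarrow> (\<lambda>n. b n / fact n * w ^ n) sums g w"
    and w: "0 < norm w" "norm w < r"
  shows "(\<lambda>n. (\<Sum>k\<le>n. of_nat (n choose k) * a k * b (n - k)) / fact n * w ^ n) sums (f w * g w)"
proof -
  obtain t where t: "norm w < t" "t < r" using w(2) dense by blast
  have nt: "norm (complex_of_real t) = t" using less_trans[OF w(1) t(1)] by simp
  have "summable (\<lambda>n. norm (a n / fact n * w ^ n))"
    using powser_insidea[of "\<lambda>n. a n / fact n" "complex_of_real t" w] a[of "complex_of_real t"] t nt w
    by (auto dest: sums_summable)
  moreover have "summable (\<lambda>n. norm (b n / fact n * w ^ n))"
    using powser_insidea[of "\<lambda>n. b n / fact n" "complex_of_real t" w] b[of "complex_of_real t"] t nt w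
    by (auto dest: sums_summable)
  ultimately have "(\<lambda>n. \<Sum>k\<le>n. (a k / fact k * w ^ k) * (b (n - k) / fact (n - k) * w ^ (n - k)))
      sums ((\<Sum>n. a n / fact n * w ^ n) * (\<Sum>n. b n / fact n * w ^ n))"
    by (rule Cauchy_product_sums)
  moreover have "(\<Sum>n. a n / fact n * w ^ n) = f w" "(\<Sum>n. b n / fact n * w ^ n) = g w"
    using a[OF w] b[OF w] by (simp_all add: sums_iff)
  moreover have "(\<Sum>k\<le>n. (a k / fact k * w ^ k) * (b (n - k) / fact (n - k) * w ^ (n - k)))
      = (\<Sum>k\<le>n. of_nat (n choose k) * a k * b (n - k)) / fact n * w ^ n" for n
    unfolding sum_divide_distrib sum_distrib_right
  proof (rule sum.cong[OF refl])
    fix k assume "k \<in> {..n}"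
    hence k: "k \<le> n" by simp
    have "w ^ n = w ^ k * w ^ (n - k)" using k by (simp flip: power_add)
    thus "(a k / fact k * w ^ k) * (b (n - k) / fact (n - k) * w ^ (n - k))
        = of_nat (n choose k) * a k * b (n - k) / fact n * w ^ n"
      by (simp add: binomial_fact[OF k])
  qed
  ultimately show ?thesis by simp
qed

lemma euler_times_bernoulli_gen_fun:
  fixes w z :: complex
  shows "(2 ^ N * exp (w * z) / (exp w + 1) ^ N) * (w ^ N * exp (w * z) / (exp w - 1) ^ N)
       = (2 * w) ^ N * exp (2 * w * z) / (exp (2 * w) - 1) ^ N"
proof -
  have "(exp w + 1) * (exp w - 1) = exp (2 * w) - 1"
    unfolding exp_double by (simp add: power2_eq_square algebra_simps)
  hence "(exp w + 1) ^ N * (exp w - 1) ^ N = (exp (2 * w) - 1) ^ N"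
    by (simp flip: power_mult_distrib)
  moreover have "exp (w * z) * exp (w * z) = exp (2 * w * z)"
    by (simp flip: exp_add add: algebra_simps)
  ultimately show ?thesis
    by (simp add: power_mult_distrib mult_ac flip: times_divide_times_eq)
qed

theorem corollary3p3:
  fixes m N :: nat and z :: complex
  assumes "N \<ge> 1"
  shows "poly (gen_bernoulli_poly N m) z =
    1 / 2 ^ m * (\<Sum>k=0..m. of_nat (m choose k) *
      poly (gen_euler_poly N k) z * poly (gen_bernoulli_poly N (m - k)) z)"
proof -
  define C :: "nat \<Rightarrow> complex poly" where
    "C n = smult (1 / 2 ^ n) (\<Sum>k\<le>n. of_nat (n choose k) *
             gen_euler_poly N k * gen_bernoulli_poly N (n - k))" for n
  have poly_C: "poly (C n) x = 1 / 2 ^ n * (\<Sum>k\<le>n. of_nat (n choose k) *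
      poly (gen_euler_poly N k) x * poly (gen_bernoulli_poly N (n - k)) x)" for n x
    by (simp add: C_def poly_sum)
  have "gen_bernoulli_poly N = C"
  proof (rule gen_bernoulli_poly_eqI)
    fix x w :: complex
    assume w: "0 < norm w" "norm w < 2 * pi"
    define u where "u = w / 2"
    have u: "0 < norm u" "norm u < pi" and wu: "w = 2 * u"
      using w by (auto simp: u_def norm_divide)
    have "(\<lambda>n. (\<Sum>k\<le>n. of_nat (n choose k) * poly (gen_euler_poly N k) x *
                 poly (gen_bernoulli_poly N (n - k)) x) / fact n * u ^ n) sums
        ((2 ^ N * exp (u * x) / (exp u + 1) ^ N) * (u ^ N * exp (u * x) / (exp u - 1) ^ N))"
      by (rule egf_product_sums[where r = pi, OF gen_euler_poly_sums gen_bernoulli_poly_sums])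
         (use u pi_gt_zero in linarith)+
    also have "(\<lambda>n. (\<Sum>k\<le>n. of_nat (n choose k) * poly (gen_euler_poly N k) x *
                 poly (gen_bernoulli_poly N (n - k)) x) / fact n * u ^ n)
        = (\<lambda>n. poly (C n) x / fact n * w ^ n)"
      by (simp add: poly_C wu power_mult_distrib)
    finally show "(\<lambda>n. poly (C n) x / fact n * w ^ n) sums
        (w ^ N * exp (w * x) / (exp w - 1) ^ N)"
      by (simp only: euler_times_bernoulli_gen_fun wu)
  qed
  thus ?thesis
    using poly_C[of m z] by (simp add: atMost_atLeast0)
qed

end
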